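(* Let $V$ be a finite dimensional (over $\mathbb{K}$) $\mathbb{K}[X]$-module with one dimensional socle (i.e. $\dim_{\mathbb{K}}\operatorname{Soc}(V)=1$). Then $V$ is isomorphic to a submodule of the $\mathbb{K}[X]$-module $D_{\alpha_1,\dots,\alpha_n}$ for some $\alpha_1,\dots,\alpha_n\in\mathbb{K}$.
   Context: $\mathbb{K}$ is an algebraically closed field of characteristic zero, $n\ge 1$, $\mathbb{K}[X]:=\mathbb{K}[x_1,\dots,x_n]$ is the polynomial algebra and $\mathbb{K}[[X]]:=\mathbb{K}[[x_1,\dots,x_n]]$ the algebra of formal power series in $n$ variables. The socle $\operatorname{Soc}(V)$ is the sum of all minimal submodules of $V$. $P_n$ denotes the $\mathbb{K}[X]$-module with underlying vector space $\mathbb{K}[[X]]$ and action $x_i\cdot f=\frac{\partial f}{\partial x_i}$, $i=1,\dots,n$. $T_n$ denotes the $\mathbb{K}[X]$-module with underlying vector space $\mathbb{K}[X]$ and the same action $x_i\cdot f=\frac{\partial f}{\partial x_i}$. For $\alpha_1,\dots,\alpha_n\in\mathbb{K}$, $D_{\alpha_1,\dots,\alpha_n}:=\exp(\alpha_1x_1+\dots+\alpha_nx_n)\,T_n=\{\exp(\alpha_1x_1+\dots+\alpha_nx_n)f : f\in\mathbb{K}[X]\}\subset\mathbb{K}[[X]]$ (product of formal power series), which is a submodule of the $\mathbb{K}[X]$-module $P_n$. *)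

theory Defs
  imports
    "HOL-Library.FuncSet"
    "HOL-Library.Poly_Mapping"
    "HOL-Library.Groups_Big_Fun"
    "HOL-Computational_Algebra.Polynomial"
begin

section \<open>Polynomials and formal power series in several variables\<close>

text \<open>
  The variables are indexed by a finite (hence nonempty) type \<open>'n\<close>. Monomials are exponent
  vectors \<open>'n \<Rightarrow>\<^sub>0 nat\<close>, and the polynomial ring is the monoid algebra
  \<open>('n \<Rightarrow>\<^sub>0 nat) \<Rightarrow>\<^sub>0 'k\<close>, whose multiplication in \<open>HOL-Library.Poly_Mapping\<close> is convolution.
\<close>

abbreviation lookup :: "('a \<Rightarrow>\<^sub>0 'b::zero) \<Rightarrow> 'a \<Rightarrow> 'b" where
  "lookup \<equiv> Poly_Mapping.lookup"

abbreviation keys :: "('a \<Rightarrow>\<^sub>0 'b::zero) \<Rightarrow> 'a set" where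
  "keys \<equiv> Poly_Mapping.keys"

type_synonym 'n expo = "'n \<Rightarrow>\<^sub>0 nat"
type_synonym ('n, 'k) mpoly = "'n expo \<Rightarrow>\<^sub>0 'k"

definition mconst :: "'k::zero \<Rightarrow> ('n, 'k) mpoly" where
  "mconst c = Poly_Mapping.single 0 c"

definition mvar :: "'n \<Rightarrow> ('n, 'k::zero_neq_one) mpoly" where
  "mvar i = Poly_Mapping.single (Poly_Mapping.single i 1) 1"

typedef ('n, 'k) mfps = "UNIV :: ('n expo \<Rightarrow> 'k) set"
  morphisms mfps_nth Abs_mfps
  by simp

lemma mfps_nth_Abs [simp]: "mfps_nth (Abs_mfps f) = f"
  by (simp add: Abs_mfps_inverse)

lemma mfps_eqI: "(\<And>m. mfps_nth f m = mfps_nth g m) \<Longrightarrow> f = g"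
  by (metis ext mfps_nth_inject)

lemma finite_expo_le: "finite {a :: 'n::finite expo. \<forall>i. lookup a i \<le> lookup m i}"
proof -
  have "inj_on lookup {a :: 'n expo. \<forall>i. lookup a i \<le> lookup m i}"
    by (simp add: inj_on_def)
  moreover have "lookup ` {a :: 'n expo. \<forall>i. lookup a i \<le> lookup m i}
                   \<subseteq> Pi\<^sub>E UNIV (\<lambda>i. {..lookup m i})"
    by auto
  then have "finite (lookup ` {a :: 'n expo. \<forall>i. lookup a i \<le> lookup m i})"
    by (rule finite_subset) (simp add: finite_PiE)
  ultimately show ?thesis
    using finite_imageD by blast
qed

lemma finite_expo_sum2: "finite {(a, b). a + b = (m :: 'n::finite expo)}"
proof (rule finite_subset)
  let ?S = "{a :: 'n expo. \<forall>i. lookup a i \<le> lookup m i}"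
  show "{(a, b). a + b = m} \<subseteq> ?S \<times> ?S"
    by (auto simp: lookup_add)
  show "finite (?S \<times> ?S)"
    by (simp add: finite_expo_le)
qed

instantiation mfps :: (finite, comm_ring_1) comm_ring_1
begin

definition zero_mfps :: "('a, 'b) mfps" where
  "zero_mfps = Abs_mfps (\<lambda>_. 0)"

definition one_mfps :: "('a, 'b) mfps" where
  "one_mfps = Abs_mfps (\<lambda>m. if m = 0 then 1 else 0)"

definition plus_mfps :: "('a, 'b) mfps \<Rightarrow> ('a, 'b) mfps \<Rightarrow> ('a, 'b) mfps" where
  "plus_mfps f g = Abs_mfps (\<lambda>m. mfps_nth f m + mfps_nth g m)"

definition uminus_mfps :: "('a, 'b) mfps \<Rightarrow> ('a, 'b) mfps" where
  "uminus_mfps f = Abs_mfps (\<lambda>m. - mfps_nth f m)"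

definition minus_mfps :: "('a, 'b) mfps \<Rightarrow> ('a, 'b) mfps \<Rightarrow> ('a, 'b) mfps" where
  "minus_mfps f g = Abs_mfps (\<lambda>m. mfps_nth f m - mfps_nth g m)"

definition times_mfps :: "('a, 'b) mfps \<Rightarrow> ('a, 'b) mfps \<Rightarrow> ('a, 'b) mfps" where
  "times_mfps f g = Abs_mfps (\<lambda>m. \<Sum>(a, b) | a + b = m. mfps_nth f a * mfps_nth g b)"

instance
proof
  fix f g h :: "('a, 'b) mfps"
  show "f + g + h = f + (g + h)" "f + g = g + f" "0 + f = f" "- f + f = 0" "f - g = f + - g"
    by (simp_all add: plus_mfps_def zero_mfps_def uminus_mfps_def minus_mfps_def
        add_ac mfps_nth_inverse)
  show "(0 :: ('a, 'b) mfps) \<noteq> 1"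
  proof
    assume "(0 :: ('a, 'b) mfps) = 1"
    then have "mfps_nth (0 :: ('a, 'b) mfps) 0 = mfps_nth (1 :: ('a, 'b) mfps) 0"
      by simp
    then show False
      by (simp add: zero_mfps_def one_mfps_def)
  qed
  show "f * g = g * f"
  proof (rule mfps_eqI)
    fix m
    show "mfps_nth (f * g) m = mfps_nth (g * f) m"
      unfolding times_mfps_def mfps_nth_Abs
      by (rule sum.reindex_bij_witness[of _ prod.swap prod.swap]) (auto simp: ac_simps)
  qed
  show "(f + g) * h = f * h + g * h"
    by (rule mfps_eqI)
      (simp add: times_mfps_def plus_mfps_def distrib_right case_prod_unfold sum.distrib)
  show "1 * f = f"
  proof (rule mfps_eqI)
    fix m
    have "mfps_nth (1 * f) m
            = (\<Sum>(a, b) | a + b = m. (if a = 0 then 1 else 0) * mfps_nth f b)"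
      by (simp add: times_mfps_def one_mfps_def)
    also have "\<dots> = (\<Sum>(a, b) \<in> {(0 :: 'a expo, m)}. (if a = 0 then 1 else 0) * mfps_nth f b)"
    proof (rule sum.mono_neutral_right)
      show "finite {(a, b). a + b = m}"
        by (rule finite_expo_sum2)
    qed (auto split: if_splits)
    finally show "mfps_nth (1 * f) m = mfps_nth f m"
      by simp
  qed
  show "f * g * h = f * (g * h)"
  proof (rule mfps_eqI)
    fix m :: "'a expo"
    let ?T = "{(a, b, c). a + b + c = m}"
    let ?t = "\<lambda>(a, b, c). mfps_nth f a * mfps_nth g b * mfps_nth h c"
    have "mfps_nth (f * g * h) m
            = (\<Sum>(p, c) | p + c = m. \<Sum>(a, b) | a + b = p. mfps_nth f a * mfps_nth g b * mfps_nth h c)"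
      by (simp add: times_mfps_def sum_distrib_right case_prod_unfold)
    also have "\<dots> = (\<Sum>(x, y) \<in> Sigma {(p, c). p + c = m} (\<lambda>x. {(a, b). a + b = fst x}).
                       mfps_nth f (fst y) * mfps_nth g (snd y) * mfps_nth h (snd x))"
      by (subst sum.Sigma[symmetric]) (auto simp: finite_expo_sum2[unfolded case_prod_unfold] case_prod_unfold)
    also have "\<dots> = sum ?t ?T"
      by (rule sum.reindex_bij_witness
          [of _ "\<lambda>(a, b, c). ((a + b, c), (a, b))" "\<lambda>(x, y). (fst y, snd y, snd x)"])
        auto
    finally have L: "mfps_nth (f * g * h) m = sum ?t ?T" .
    have "mfps_nth (f * (g * h)) m
            = (\<Sum>(a, p) | a + p = m. \<Sum>(b, c) | b + c = p. mfps_nth f a * mfps_nth g b * mfps_nth h c)"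
      by (simp add: times_mfps_def sum_distrib_left case_prod_unfold mult.assoc)
    also have "\<dots> = (\<Sum>(x, y) \<in> Sigma {(a, p). a + p = m} (\<lambda>x. {(b, c). b + c = snd x}).
                       mfps_nth f (fst x) * mfps_nth g (fst y) * mfps_nth h (snd y))"
      by (subst sum.Sigma[symmetric]) (auto simp: finite_expo_sum2[unfolded case_prod_unfold] case_prod_unfold)
    also have "\<dots> = sum ?t ?T"
      by (rule sum.reindex_bij_witness
          [of _ "\<lambda>(a, b, c). ((a, b + c), (b, c))" "\<lambda>(x, y). (fst x, fst y, snd y)"])
        (auto simp: add.assoc)
    finally show "mfps_nth (f * g * h) m = mfps_nth (f * (g * h)) m"
      using L by simp
  qed
qed

end

definition mfps_smult :: "'k \<Rightarrow> ('n, 'k::times) mfps \<Rightarrow> ('n, 'k) mfps" where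
  "mfps_smult c f = Abs_mfps (\<lambda>m. c * mfps_nth f m)"

definition mfps_of_mpoly :: "('n, 'k::zero) mpoly \<Rightarrow> ('n, 'k) mfps" where
  "mfps_of_mpoly p = Abs_mfps (lookup p)"

definition mfps_deriv :: "'n \<Rightarrow> ('n, 'k::semiring_1) mfps \<Rightarrow> ('n, 'k) mfps" where
  "mfps_deriv i f =
     Abs_mfps (\<lambda>m. of_nat (lookup m i + 1) * mfps_nth f (m + Poly_Mapping.single i 1))"

text \<open>
  \<open>exp h = (\<Sum>k. h ^ k / k!)\<close>, summed coefficientwise. If \<open>h\<close> has zero constant term, then only
  finitely many \<open>k\<close> contribute to each coefficient (lemma \<open>finite_mfps_exp_support\<close>), so that
  \<open>Sum_any\<close> is the genuine sum; for other \<open>h\<close> the series does not exist.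
\<close>
definition mfps_exp :: "('n::finite, 'k::field_char_0) mfps \<Rightarrow> ('n, 'k) mfps" where
  "mfps_exp h = Abs_mfps (\<lambda>m. Sum_any (\<lambda>k. mfps_nth (h ^ k) m / fact k))"

definition linear_form :: "('n::finite \<Rightarrow> 'k::comm_ring_1) \<Rightarrow> ('n, 'k) mpoly" where
  "linear_form \<alpha> = (\<Sum>i\<in>UNIV. mconst (\<alpha> i) * mvar i)"

lemma mfps_nth_power_eq_0:
  fixes h :: "('n::finite, 'k::comm_ring_1) mfps"
  assumes "mfps_nth h 0 = 0" and "(\<Sum>i\<in>UNIV. lookup m i) < k"
  shows "mfps_nth (h ^ k) m = 0"
  using assms(2)
proof (induction k arbitrary: m)
  case 0
  then show ?case by simp
next
  case (Suc k)
  have "mfps_nth h a * mfps_nth (h ^ k) b = 0" if "a + b = m" for a b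
  proof (cases "a = 0")
    case True
    then show ?thesis using assms(1) by simp
  next
    case False
    then obtain j where "lookup a j \<noteq> 0"
      by (metis poly_mapping_eqI lookup_zero)
    then have "lookup b j < lookup m j"
      using that by (auto simp: lookup_add)
    moreover have "lookup b i \<le> lookup m i" for i
      using that by (auto simp: lookup_add)
    ultimately have "(\<Sum>i\<in>UNIV. lookup b i) < (\<Sum>i\<in>UNIV. lookup m i)"
      by (intro sum_strict_mono_ex1) auto
    then show ?thesis
      using Suc by simp
  qed
  then show ?case
    by (auto simp: times_mfps_def intro!: sum.neutral)
qed

lemma finite_mfps_exp_support:
  fixes h :: "('n::finite, 'k::field_char_0) mfps"
  assumes "mfps_nth h 0 = 0"
  shows "finite {k. mfps_nth (h ^ k) m / fact k \<noteq> 0}"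
proof (rule finite_subset)
  show "{k. mfps_nth (h ^ k) m / fact k \<noteq> 0} \<subseteq> {..(\<Sum>i\<in>UNIV. lookup m i)}"
    using mfps_nth_power_eq_0[OF assms] by (force simp: not_less[symmetric])
qed simp

lemma linear_form_const_coeff:
  fixes \<alpha> :: "'n::finite \<Rightarrow> 'k::comm_ring_1"
  shows
  "mfps_nth (mfps_of_mpoly (linear_form \<alpha>)) 0 = 0"
  proof -
  have "Poly_Mapping.single i (1::nat) \<noteq> 0" for i :: 'n
    by (metis lookup_single_eq lookup_zero zero_neq_one)
  then show ?thesis
    by (simp add: mfps_of_mpoly_def linear_form_def lookup_sum mconst_def mvar_def mult_single
        lookup_single when_def)
qed

section \<open>The modules of power series under differentiation\<close>

text \<open>
  \<open>mfps_derivs m\<close> is the composition of the commuting operators \<open>mfps_deriv i ^^ lookup m i\<close>, and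
  \<open>P_act\<close> is the extension of \<open>x_i \<cdot> f = mfps_deriv i f\<close> to an action of the polynomial ring; see
  \<open>module_P_act\<close>, \<open>P_act_mconst\<close> and \<open>P_act_mvar\<close>.
\<close>
definition mfps_derivs :: "'n::finite expo \<Rightarrow> ('n, 'k::semiring_1) mfps \<Rightarrow> ('n, 'k) mfps" where
  "mfps_derivs m f = Finite_Set.fold (\<lambda>i. mfps_deriv i ^^ lookup m i) f UNIV"

definition P_act :: "('n::finite, 'k::comm_ring_1) mpoly \<Rightarrow> ('n, 'k) mfps \<Rightarrow> ('n, 'k) mfps" where
  "P_act p f = (\<Sum>m\<in>keys p. mfps_smult (lookup p m) (mfps_derivs m f))"

lemma mfps_nth_deriv_funpow:
  fixes f :: "('n, 'k::comm_ring_1) mfps"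
  shows "mfps_nth ((mfps_deriv i ^^ k) f) a
           = pochhammer (of_nat (lookup a i + 1)) k * mfps_nth f (a + Poly_Mapping.single i k)"
proof (induction k arbitrary: a)
  case 0
  then show ?case by simp
next
  case (Suc k)
  have "a + Poly_Mapping.single i 1 + Poly_Mapping.single i k = a + Poly_Mapping.single i (Suc k)"
    by (simp add: add.assoc flip: single_add)
  then show ?case
    using Suc.IH[of "a + Poly_Mapping.single i 1"]
    by (simp add: mfps_deriv_def[of i "(mfps_deriv i ^^ k) f"] lookup_add pochhammer_rec
        algebra_simps)
qed

lemma comp_fun_commute_mfps_deriv:
  "comp_fun_commute (\<lambda>i. (mfps_deriv i :: ('n, 'k::comm_ring_1) mfps \<Rightarrow> _) ^^ lookup m i)"
proof
  fix i j :: 'n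
  show "(mfps_deriv j ^^ lookup m j) \<circ> (mfps_deriv i ^^ lookup m i)
      = (mfps_deriv i ^^ lookup m i) \<circ> (mfps_deriv j ^^ lookup m j :: ('n, 'k) mfps \<Rightarrow> _)"
  proof (cases "i = j")
    case False
    then show ?thesis
      by (intro ext mfps_eqI)
        (simp add: mfps_nth_deriv_funpow lookup_add lookup_single ac_simps)
  qed simp
qed

lemma mfps_nth_derivs:
  fixes f :: "('n::finite, 'k::comm_ring_1) mfps"
  shows "mfps_nth (mfps_derivs m f) a
           = (\<Prod>i\<in>UNIV. pochhammer (of_nat (lookup a i + 1)) (lookup m i)) * mfps_nth f (a + m)"
proof -
  interpret comp_fun_commute "\<lambda>i. (mfps_deriv i :: ('n, 'k) mfps \<Rightarrow> _) ^^ lookup m i"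
    by (rule comp_fun_commute_mfps_deriv)
  have "mfps_nth (Finite_Set.fold (\<lambda>i. mfps_deriv i ^^ lookup m i) f A) a
          = (\<Prod>i\<in>A. pochhammer (of_nat (lookup a i + 1)) (lookup m i))
            * mfps_nth f (a + (\<Sum>i\<in>A. Poly_Mapping.single i (lookup m i)))"
    if "finite A" for A
    using that
  proof (induction A arbitrary: a)
    case empty
    then show ?case by simp
  next
    case (insert j A)
    have "lookup (a + Poly_Mapping.single j (lookup m j)) i = lookup a i" if "i \<in> A" for i
      using insert.hyps that by (auto simp: lookup_add lookup_single when_def)
    then have "(\<Prod>i\<in>A. pochhammer (of_nat (lookup (a + Poly_Mapping.single j (lookup m j)) i + 1))
                          (lookup m i))
             = (\<Prod>i\<in>A. pochhammer (of_nat (lookup a i + 1) :: 'k) (lookup m i))"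
      by (intro prod.cong) auto
    with insert show ?case
      by (simp add: mfps_nth_deriv_funpow mult.assoc add.assoc)
  qed
  moreover have "(\<Sum>i\<in>UNIV. Poly_Mapping.single i (lookup m i)) = m"
    by (intro poly_mapping_eqI) (simp add: lookup_sum lookup_single when_def)
  ultimately show ?thesis
    by (simp add: mfps_derivs_def)
qed

lemma mfps_derivs_add:
  fixes f :: "('n::finite, 'k::comm_ring_1) mfps"
  shows "mfps_derivs (m + m') f = mfps_derivs m (mfps_derivs m' f)"
proof (rule mfps_eqI)
  fix a
  have "pochhammer (of_nat (lookup a i + 1) :: 'k) (lookup m i + lookup m' i)
        = pochhammer (of_nat (lookup a i + 1)) (lookup m i)
          * pochhammer (of_nat (lookup (a + m) i + 1)) (lookup m' i)" for i
    by (simp add: pochhammer_product'[of _ "lookup m i" "lookup m' i"] lookup_add ac_simps)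
  then show "mfps_nth (mfps_derivs (m + m') f) a
           = mfps_nth (mfps_derivs m (mfps_derivs m' f)) a"
    by (simp add: mfps_nth_derivs lookup_add prod.distrib ac_simps)
qed

lemma mfps_nth_0 [simp]: "mfps_nth 0 m = 0"
  by (simp add: zero_mfps_def)

lemma mfps_nth_add [simp]: "mfps_nth (f + g) m = mfps_nth f m + mfps_nth g m"
  by (simp add: plus_mfps_def)

lemma mfps_nth_smult [simp]: "mfps_nth (mfps_smult c f) m = c * mfps_nth f m"
  by (simp add: mfps_smult_def)

lemma mfps_nth_sum: "mfps_nth (sum f A) m = (\<Sum>x\<in>A. mfps_nth (f x) m)"
  by (induction A rule: infinite_finite_induct) auto

lemma mfps_nth_P_act_superset:
  assumes "finite A" "keys p \<subseteq> A"
  shows "mfps_nth (P_act p f) a = (\<Sum>m\<in>A. lookup p m * mfps_nth (mfps_derivs m f) a)"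
  unfolding P_act_def mfps_nth_sum mfps_nth_smult
  by (rule sum.mono_neutral_left) (use assms in \<open>auto simp: in_keys_iff\<close>)

lemma P_act_single [simp]: "P_act (Poly_Mapping.single m c) f = mfps_smult c (mfps_derivs m f)"
  by (rule mfps_eqI) (simp add: mfps_nth_P_act_superset[of "{m}"])

lemma P_act_add_left: "P_act (p + q) f = P_act p f + P_act q f"
proof (rule mfps_eqI)
  fix a
  have *: "keys (p + q) \<subseteq> keys p \<union> keys q" "finite (keys p \<union> keys q)"
    by (auto dest: subsetD[OF keys_add])
  then show "mfps_nth (P_act (p + q) f) a = mfps_nth (P_act p f + P_act q f) a"
    by (simp add: mfps_nth_P_act_superset[of "keys p \<union> keys q"] lookup_add distrib_right
        sum.distrib)
qed

lemma P_act_add_right: "P_act p (f + g) = P_act p f + P_act p g"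
  by (rule mfps_eqI)
    (simp add: P_act_def mfps_nth_sum mfps_nth_derivs distrib_left sum.distrib)

lemma P_act_0_left [simp]: "P_act 0 f = 0"
  by (simp add: P_act_def)

lemma P_act_sum_left: "P_act (sum p A) f = (\<Sum>x\<in>A. P_act (p x) f)"
  by (induction A rule: infinite_finite_induct) (auto simp: P_act_add_left)

lemma P_act_mult_single:
  "P_act (Poly_Mapping.single m c * q) f = P_act (Poly_Mapping.single m c) (P_act q f)"
proof -
  have q: "q = (\<Sum>m\<in>keys q. Poly_Mapping.single m (lookup q m))"
    by (rule poly_mapping_eqI)
      (auto simp: lookup_sum lookup_single when_def in_keys_iff)
  have "P_act (Poly_Mapping.single m c * q) f
          = P_act (\<Sum>m'\<in>keys q. Poly_Mapping.single (m + m') (c * lookup q m')) f"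
    by (subst q) (simp add: sum_distrib_left mult_single)
  also have "\<dots> = P_act (Poly_Mapping.single m c) (P_act q f)"
    unfolding P_act_sum_left P_act_single mfps_derivs_add
    by (rule mfps_eqI)
      (simp add: mfps_nth_sum mfps_nth_derivs P_act_def
        sum_distrib_left ac_simps)
  finally show ?thesis .
qed

lemma P_act_mult: "P_act (p * q) f = P_act p (P_act q f)"
proof -
  have p: "p = (\<Sum>m\<in>keys p. Poly_Mapping.single m (lookup p m))"
    by (rule poly_mapping_eqI)
      (auto simp: lookup_sum lookup_single when_def in_keys_iff)
  have "P_act (p * q) f = (\<Sum>m\<in>keys p. P_act (Poly_Mapping.single m (lookup p m) * q) f)"
    by (subst p) (simp only: sum_distrib_right P_act_sum_left)
  also have "\<dots> = P_act (\<Sum>m\<in>keys p. Poly_Mapping.single m (lookup p m)) (P_act q f)"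
    by (simp only: P_act_mult_single P_act_sum_left)
  finally show ?thesis
    using p by simp
qed

lemma P_act_mconst: "P_act (mconst c) f = mfps_smult c f"
  by (rule mfps_eqI) (simp add: mconst_def mfps_nth_derivs)

lemma P_act_mvar: "P_act (mvar i) f = mfps_deriv i f"
proof (rule mfps_eqI)
  fix a
  have "(\<Prod>j\<in>UNIV. pochhammer (of_nat (lookup a j + 1)) (lookup (Poly_Mapping.single i 1) j))
      = (\<Prod>j\<in>UNIV. if j = i then of_nat (lookup a i + 1) else (1 :: 'b))"
    by (intro prod.cong) (auto simp: lookup_single when_def)
  then show "mfps_nth (P_act (mvar i) f) a = mfps_nth (mfps_deriv i f) a"
    by (simp add: mvar_def mfps_nth_derivs mfps_deriv_def)
qed

lemma module_P_act:
  "module (P_act :: ('n::finite, 'k::comm_ring_1) mpoly \<Rightarrow> ('n, 'k) mfps \<Rightarrow> _)"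
proof
  show "P_act 1 f = f" for f :: "('n, 'k) mfps"
    using P_act_mconst[of 1 f]
    by (simp add: mconst_def mfps_smult_def mfps_nth_inverse flip: single_one)
qed (simp_all add: P_act_add_left P_act_add_right P_act_mult)

definition D_set :: "('n::finite \<Rightarrow> 'k::field_char_0) \<Rightarrow> ('n, 'k) mfps set" where
  "D_set \<alpha> = {mfps_exp (mfps_of_mpoly (linear_form \<alpha>)) * mfps_of_mpoly f | f. True}"

section \<open>Socle and underlying vector space\<close>

definition minimal_submodule :: "('r::comm_ring_1 \<Rightarrow> 'v::ab_group_add \<Rightarrow> 'v) \<Rightarrow> 'v set \<Rightarrow> bool" where
  "minimal_submodule s M \<longleftrightarrow> module.subspace s M \<and> M \<noteq> {0} \<and>
     (\<forall>N. module.subspace s N \<and> N \<subseteq> M \<longrightarrow> N = {0} \<or> N = M)"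

definition socle :: "('r::comm_ring_1 \<Rightarrow> 'v::ab_group_add \<Rightarrow> 'v) \<Rightarrow> 'v set" where
  "socle s = module.span s (\<Union>{M. minimal_submodule s M})"

definition restrict_scalars ::
    "(('n, 'k::zero) mpoly \<Rightarrow> 'v \<Rightarrow> 'v) \<Rightarrow> 'k \<Rightarrow> 'v \<Rightarrow> 'v" where
  "restrict_scalars s c v = s (mconst c) v"

lemma vector_space_restrict_scalars:
  fixes s :: "('n, 'k::field) mpoly \<Rightarrow> 'v::ab_group_add \<Rightarrow> 'v"
  assumes "module s"
  shows "vector_space (restrict_scalars s)"
proof -
  interpret module s by fact
  show ?thesis
  proof
    show "restrict_scalars s 1 x = x" for x
      by (simp add: restrict_scalars_def mconst_def)
    show "restrict_scalars s a (restrict_scalars s b x) = restrict_scalars s (a * b) x" for a b x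
      by (simp add: restrict_scalars_def mconst_def mult_single)
  qed (simp_all add: restrict_scalars_def mconst_def single_add scale_left_distrib
      scale_right_distrib)
qed

end

theory Submission
  imports Defs
begin

text \<open>
  A vector \<open>u\<close> spanning the socle lies in every nonzero submodule of \<open>V\<close>, because every nonzero
  submodule contains a minimal one. It is also a common eigenvector, \<open>x_i u = \<alpha>_i u\<close>, and these
  eigenvalues are the wanted \<open>\<alpha>_i\<close>. On \<open>V\<close> each \<open>x_i - \<alpha>_i\<close> is nilpotent: otherwise the stable image
  of its powers would be a nonzero submodule that meets its kernel trivially, although both contain
  \<open>u\<close> (\<open>one_dimensional_socle_vector\<close>, \<open>nilpotent_if_kills_common_vector\<close>).

  Let \<open>l\<close> be a linear functional on \<open>V\<close> with \<open>l u = 1\<close>. The Taylor series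
  \<open>g v = (\<Sum>m. l ((x - \<alpha>)^m v) x^m / m!)\<close> is a polynomial by nilpotence, and it satisfies
  \<open>\<partial>(g v)/\<partial>x_i = g ((x_i - \<alpha>_i) v)\<close>. With \<open>E = exp (\<Sum>i. \<alpha>_i x_i)\<close>, which satisfies \<open>\<partial>E/\<partial>x_i = \<alpha>_i E\<close>,
  the product rule gives \<open>\<partial>(E * g v)/\<partial>x_i = E * g (x_i v)\<close>. Hence \<open>\<phi> v = E * g v\<close> is a module
  homomorphism with values in \<open>D_set \<alpha>\<close>. Its kernel is a submodule that does not contain \<open>u\<close>, as
  \<open>\<phi> u\<close> has constant term \<open>l u = 1\<close>; therefore the kernel is zero and \<open>\<phi>\<close> is an isomorphism onto
  its image.
\<close>

section \<open>Differentiating power series\<close>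

lemma mfps_nth_1: "mfps_nth 1 m = (if m = 0 then 1 else 0)"
  by (simp add: one_mfps_def)

lemma mfps_nth_mult: "mfps_nth (f * g) m = (\<Sum>(a, b) | a + b = m. mfps_nth f a * mfps_nth g b)"
  by (simp add: times_mfps_def)

lemma mfps_nth_mult_0: "mfps_nth (f * g) 0 = mfps_nth f 0 * mfps_nth g 0"
  for f g :: "('n::finite, 'k::comm_ring_1) mfps"
proof -
  have "a + b = 0 \<longleftrightarrow> a = 0 \<and> b = 0" for a b :: "'n expo"
    by (auto simp: poly_mapping_eq_iff fun_eq_iff lookup_add)
  then have "{(a, b). a + b = (0 :: 'n expo)} = {(0, 0)}"
    by auto
  then show ?thesis
    by (simp add: mfps_nth_mult)
qed

lemma mfps_nth_deriv:
  "mfps_nth (mfps_deriv i f) m = of_nat (lookup m i + 1) * mfps_nth f (m + Poly_Mapping.single i 1)"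
  by (simp add: mfps_deriv_def)

lemma mfps_smult_mult_left: "mfps_smult c f * g = mfps_smult c (f * g)"
  for f g :: "('n::finite, 'k::comm_ring_1) mfps"
  by (rule mfps_eqI) (simp add: mfps_nth_mult sum_distrib_left case_prod_unfold mult.assoc)

lemma mfps_smult_mult_right: "f * mfps_smult c g = mfps_smult c (f * g)"
  for f g :: "('n::finite, 'k::comm_ring_1) mfps"
  by (metis mfps_smult_mult_left mult.commute)

text \<open>
  Summing over \<open>a + b = m + e_i\<close> instead of \<open>a + b = m\<close> undoes the index shift of \<open>\<partial>/\<partial>x_i\<close>. In this
  form the two halves of the product rule range over the same index set, where the weights add up to
  \<open>a_i + b_i = m_i + 1\<close>. The new terms with \<open>a_i = 0\<close> vanish; in the others \<open>x_i\<close> divides \<open>x^a\<close>.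
\<close>
lemma mfps_nth_deriv_mult:
  fixes f g :: "('n::finite, 'k::comm_ring_1) mfps"
  shows "mfps_nth (mfps_deriv i f * g) m =
    (\<Sum>(a, b) | a + b = m + Poly_Mapping.single i 1. of_nat (lookup a i) * mfps_nth f a * mfps_nth g b)"
proof -
  let ?e = "Poly_Mapping.single i 1 :: 'n expo"
  let ?S = "{(a, b). a + b = m + ?e}"
  have split: "?e + (a - ?e) = a" if "lookup a i \<noteq> 0" for a :: "'n expo"
    using that by (intro poly_mapping_eqI) (auto simp: lookup_add lookup_minus lookup_single when_def)
  have "mfps_nth (mfps_deriv i f * g) m =
    (\<Sum>(a, b) | a + b = m. of_nat (lookup a i + 1) * mfps_nth f (a + ?e) * mfps_nth g b)"
    by (simp add: mfps_nth_mult mfps_nth_deriv)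
  also have "\<dots> = (\<Sum>(a, b) \<in> {(a, b) \<in> ?S. lookup a i \<noteq> 0}.
      of_nat (lookup a i) * mfps_nth f a * mfps_nth g b)"
  proof (rule sum.reindex_bij_witness
      [of _ "\<lambda>(a, b). (a - ?e, b)" "\<lambda>(a, b). (a + ?e, b)"])
    show "(case x of (a, b) \<Rightarrow> (a - ?e, b)) \<in> {(a, b). a + b = m}"
      if mem: "x \<in> {(a, b) \<in> ?S. lookup a i \<noteq> 0}" for x
    proof -
      obtain a b where x: "x = (a, b)" "a + b = m + ?e" "lookup a i \<noteq> 0"
        using mem by auto
      have "(a - ?e + b) + ?e = m + ?e"
        using split[OF x(3)] x(2) by (metis add.assoc add.commute)
      then show ?thesis using x by simp
    qed
  qed (auto simp: split lookup_add lookup_single ac_simps simp del: One_nat_def)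
  also have "\<dots> = (\<Sum>(a, b) \<in> ?S. of_nat (lookup a i) * mfps_nth f a * mfps_nth g b)"
    by (rule sum.mono_neutral_left) (auto simp: finite_expo_sum2 intro!: gr0I)
  finally show ?thesis .
qed

lemma mfps_deriv_mult:
  fixes f g :: "('n::finite, 'k::comm_ring_1) mfps"
  shows "mfps_deriv i (f * g) = mfps_deriv i f * g + f * mfps_deriv i g"
proof (rule mfps_eqI)
  fix m
  let ?e = "Poly_Mapping.single i 1 :: 'n expo"
  let ?S = "{(a, b). a + b = m + ?e}"
  have weight: "of_nat (lookup m i + 1) = (of_nat (lookup a i) + of_nat (lookup b i) :: 'k)"
    if "a + b = m + ?e" for a b
    using arg_cong[OF that, of "\<lambda>c. lookup c i"] by (simp add: lookup_add flip: of_nat_add)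
  have "mfps_nth (mfps_deriv i (f * g)) m =
      (\<Sum>(a, b) \<in> ?S. of_nat (lookup m i + 1) * (mfps_nth f a * mfps_nth g b))"
    by (simp only: mfps_nth_deriv mfps_nth_mult sum_distrib_left case_prod_unfold)
  also have "\<dots> = (\<Sum>(a, b) \<in> ?S. of_nat (lookup a i) * mfps_nth f a * mfps_nth g b
      + of_nat (lookup b i) * mfps_nth g b * mfps_nth f a)"
  proof (intro sum.cong refl, clarify)
    fix a b
    assume "a + b = m + ?e"
    show "of_nat (lookup m i + 1) * (mfps_nth f a * mfps_nth g b) =
        of_nat (lookup a i) * mfps_nth f a * mfps_nth g b
          + of_nat (lookup b i) * mfps_nth g b * mfps_nth f a"
      unfolding weight[OF \<open>a + b = m + ?e\<close>] by (simp add: algebra_simps)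
  qed
  also have "\<dots> = mfps_nth (mfps_deriv i f * g) m +
      (\<Sum>(a, b) \<in> ?S. of_nat (lookup b i) * mfps_nth g b * mfps_nth f a)"
    by (simp only: mfps_nth_deriv_mult sum.distrib case_prod_unfold)
  also have "(\<Sum>(a, b) \<in> ?S. of_nat (lookup b i) * mfps_nth g b * mfps_nth f a)
      = mfps_nth (mfps_deriv i g * f) m"
    unfolding mfps_nth_deriv_mult
    by (rule sum.reindex_bij_witness[of _ prod.swap prod.swap]) (auto simp: ac_simps)
  finally show "mfps_nth (mfps_deriv i (f * g)) m =
      mfps_nth (mfps_deriv i f * g + f * mfps_deriv i g) m"
    by (simp add: mult.commute)
qed

lemma mfps_deriv_power_Suc:
  fixes h :: "('n::finite, 'k::comm_ring_1) mfps"
  shows "mfps_deriv i (h ^ Suc k) = mfps_smult (of_nat (Suc k)) (mfps_deriv i h * h ^ k)"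
proof (induction k)
  case 0
  then show ?case by (intro mfps_eqI) simp
next
  case (Suc k)
  have "mfps_deriv i (h ^ Suc (Suc k)) =
      mfps_deriv i h * h ^ Suc k + mfps_smult (of_nat (Suc k)) (mfps_deriv i h * h ^ Suc k)"
    using Suc by (simp add: mfps_deriv_mult mfps_smult_mult_right mult.left_commute)
  then show ?case
    by (intro mfps_eqI) (simp add: algebra_simps)
qed

section \<open>The exponential series\<close>

lemma mfps_nth_exp_truncated:
  fixes h :: "('n::finite, 'k::field_char_0) mfps"
  assumes "mfps_nth h 0 = 0" and "(\<Sum>i\<in>UNIV. lookup m i) \<le> N"
  shows "mfps_nth (mfps_exp h) m = (\<Sum>k\<le>N. mfps_nth (h ^ k) m / fact k)"
proof -
  have "{k. mfps_nth (h ^ k) m / fact k \<noteq> 0} \<subseteq> {..N}"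
    using mfps_nth_power_eq_0[OF assms(1)] assms(2) by (force simp: not_less[symmetric])
  then show ?thesis
    by (simp add: mfps_exp_def Sum_any.expand_superset)
qed

lemma mfps_nth_exp_0:
  fixes h :: "('n::finite, 'k::field_char_0) mfps"
  assumes "mfps_nth h 0 = 0"
  shows "mfps_nth (mfps_exp h) 0 = 1"
  using mfps_nth_exp_truncated[OF assms, of 0 0] by (simp add: mfps_nth_1)

text \<open>
  A fixed coefficient of either side involves only coefficients of bounded total degree, so \<open>exp h\<close>
  may be replaced by its partial sums, for which the identity is the power rule and a shift of the
  summation index.
\<close>
lemma mfps_deriv_exp:
  fixes h :: "('n::finite, 'k::field_char_0) mfps"
  assumes h: "mfps_nth h 0 = 0"
  shows "mfps_deriv i (mfps_exp h) = mfps_deriv i h * mfps_exp h"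
proof (rule mfps_eqI)
  fix m :: "'n expo"
  define N where "N = (\<Sum>j\<in>UNIV. lookup m j)"
  let ?e = "Poly_Mapping.single i 1 :: 'n expo"
  have degree_Suc: "(\<Sum>j\<in>UNIV. lookup (m + ?e) j) = Suc N"
    by (simp add: N_def lookup_add lookup_single sum.distrib when_def)
  have nonzero: "m + ?e \<noteq> 0"
    using degree_Suc by (auto simp del: One_nat_def)
  have degree_le: "(\<Sum>j\<in>UNIV. lookup b j) \<le> N" if "a + b = m" for a b
    unfolding N_def that[symmetric] lookup_add by (rule sum_mono) simp
  have "mfps_nth (mfps_deriv i (mfps_exp h)) m =
      (\<Sum>k\<le>Suc N. mfps_nth (mfps_deriv i (h ^ k)) m / fact k)"
    by (simp add: mfps_nth_deriv mfps_nth_exp_truncated[OF h degree_Suc[THEN eq_refl]]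
        sum_distrib_left del: sum.atMost_Suc One_nat_def)
  also have "\<dots> = (\<Sum>k\<le>N. mfps_nth (mfps_deriv i (h ^ Suc k)) m / fact (Suc k))"
    by (subst sum.atMost_Suc_shift) (simp add: mfps_nth_deriv mfps_nth_1 nonzero del: One_nat_def)
  also have "\<dots> = (\<Sum>k\<le>N. mfps_nth (mfps_deriv i h * h ^ k) m / fact k)"
    by (rule sum.cong) (simp_all add: mfps_deriv_power_Suc divide_simps del: power_Suc of_nat_Suc)
  also have "\<dots> = (\<Sum>(a, b) | a + b = m. mfps_nth (mfps_deriv i h) a * (\<Sum>k\<le>N. mfps_nth (h ^ k) b / fact k))"
    by (simp add: mfps_nth_mult sum_divide_distrib sum_distrib_left case_prod_unfold)
      (rule sum.swap)
  also have "\<dots> = (\<Sum>(a, b) | a + b = m. mfps_nth (mfps_deriv i h) a * mfps_nth (mfps_exp h) b)"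
    by (rule sum.cong) (auto simp: mfps_nth_exp_truncated[OF h degree_le])
  finally show "mfps_nth (mfps_deriv i (mfps_exp h)) m = mfps_nth (mfps_deriv i h * mfps_exp h) m"
    by (simp add: mfps_nth_mult)
qed

lemma mfps_deriv_linear_form:
  fixes \<alpha> :: "'n::finite \<Rightarrow> 'k::comm_ring_1"
  shows "mfps_deriv i (mfps_of_mpoly (linear_form \<alpha>)) = mfps_smult (\<alpha> i) 1"
proof (rule mfps_eqI)
  fix m :: "'n expo"
  let ?e = "\<lambda>j. Poly_Mapping.single j 1 :: 'n expo"
  have unit: "?e j = m + ?e i \<longleftrightarrow> m = 0 \<and> j = i" for j
  proof
    assume eq: "?e j = m + ?e i"
    have "j = i"
      using arg_cong[OF eq, of "\<lambda>c. lookup c i"]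
      by (simp add: lookup_add lookup_single when_def split: if_splits)
    with eq show "m = 0 \<and> j = i" by simp
  qed simp
  show "mfps_nth (mfps_deriv i (mfps_of_mpoly (linear_form \<alpha>))) m = mfps_nth (mfps_smult (\<alpha> i) 1) m"
    using unit
    by (cases "m = 0")
      (simp_all add: mfps_nth_deriv mfps_of_mpoly_def linear_form_def lookup_sum mconst_def mvar_def
        mult_single lookup_single mfps_nth_1 when_def)
qed

lemma mfps_deriv_exp_linear_form:
  fixes \<alpha> :: "'n::finite \<Rightarrow> 'k::field_char_0"
  defines "E \<equiv> mfps_exp (mfps_of_mpoly (linear_form \<alpha>))"
  shows "mfps_deriv i E = mfps_smult (\<alpha> i) E"
  unfolding E_def
  by (simp add: mfps_deriv_exp linear_form_const_coeff mfps_deriv_linear_form mfps_smult_mult_left)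

section \<open>Maps that commute with the variables\<close>

lemma mpoly_generated_by_variables [case_names const var add mult]:
  fixes p :: "('n::finite, 'k::comm_ring_1) mpoly"
  assumes const: "\<And>c. Q (mconst c)" and var: "\<And>i. Q (mvar i)"
    and add: "\<And>p q. Q p \<Longrightarrow> Q q \<Longrightarrow> Q (p + q)" and mult: "\<And>p q. Q p \<Longrightarrow> Q q \<Longrightarrow> Q (p * q)"
  shows "Q p"
proof -
  have one: "Q 1"
    using const[of 1] by (simp add: mconst_def)
  have zero: "Q 0"
    using const[of 0] by (simp add: mconst_def)
  have power: "Q (Poly_Mapping.single (Poly_Mapping.single i k) 1)" for i k
  proof (induction k)
    case (Suc k)
    have "Poly_Mapping.single (Poly_Mapping.single i (Suc k)) 1 =
        (mvar i * Poly_Mapping.single (Poly_Mapping.single i k) 1 :: ('n, 'k) mpoly)"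
      by (simp add: mvar_def mult_single flip: single_add)
    then show ?case using mult[OF var Suc] by simp
  qed (simp add: one)
  have monomial: "Q (Poly_Mapping.single (\<Sum>i\<in>A. Poly_Mapping.single i (lookup m i)) 1)"
    if "finite A" for A and m :: "'n expo"
    using that
  proof (induction A)
    case (insert j A)
    then show ?case
      using mult[OF power[of j "lookup m j"] insert.IH] by (simp add: mult_single)
  qed (simp add: one)
  have scaled: "Q (Poly_Mapping.single m c)" for m c
  proof -
    have "(\<Sum>i\<in>UNIV. Poly_Mapping.single i (lookup m i)) = m"
      by (intro poly_mapping_eqI) (simp add: lookup_sum lookup_single when_def)
    then show ?thesis
      using mult[OF const[of c] monomial[of UNIV m]] by (simp add: mconst_def mult_single)
  qed
  have "Q (\<Sum>m\<in>A. Poly_Mapping.single m (lookup p m))" if "finite A" for A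
    using that by induction (auto simp: zero intro: add scaled)
  moreover have "p = (\<Sum>m\<in>keys p. Poly_Mapping.single m (lookup p m))"
    by (rule poly_mapping_eqI) (auto simp: lookup_sum lookup_single when_def in_keys_iff)
  ultimately show ?thesis
    by (metis finite_keys)
qed

text \<open>Scalars and variables generate the polynomial ring, so equivariance is checked on them.\<close>
lemma module_hom_P_actI:
  fixes s :: "('n::finite, 'k::comm_ring_1) mpoly \<Rightarrow> 'v::ab_group_add \<Rightarrow> 'v"
  assumes "module s"
    and add: "\<And>v w. \<phi> (v + w) = \<phi> v + \<phi> w"
    and const: "\<And>c v. \<phi> (s (mconst c) v) = mfps_smult c (\<phi> v)"
    and var: "\<And>i v. \<phi> (s (mvar i) v) = mfps_deriv i (\<phi> v)"
  shows "module_hom s P_act \<phi>"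
proof -
  interpret s: module s by fact
  interpret P: module "P_act :: ('n, 'k) mpoly \<Rightarrow> ('n, 'k) mfps \<Rightarrow> _" by (rule module_P_act)
  have "\<phi> (s p v) = P_act p (\<phi> v)" for p v
  proof (induction p arbitrary: v rule: mpoly_generated_by_variables)
    case (add p q)
    then show ?case by (simp add: s.scale_left_distrib P.scale_left_distrib assms(2))
  next
    case (mult p q)
    then show ?case by (simp flip: s.scale_scale P.scale_scale)
  qed (simp_all add: const var P_act_mconst P_act_mvar)
  then show ?thesis
    by unfold_locales (rule add)
qed

section \<open>Modules with one-dimensional socle\<close>

lemma finite_dimensional_restrict_scalars:
  fixes s :: "('n::finite, 'k::field) mpoly \<Rightarrow> 'v::ab_group_add \<Rightarrow> 'v"
  assumes "module s" and "\<exists>B. finite B \<and> module.span (restrict_scalars s) B = UNIV"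
  obtains B where "finite_dimensional_vector_space (restrict_scalars s) B"
proof -
  interpret vs: vector_space "restrict_scalars s"
    by (rule vector_space_restrict_scalars) fact
  obtain B where B: "finite B" "vs.span B = UNIV"
    using assms(2) by blast
  obtain C where C: "C \<subseteq> B" "vs.independent C" "B \<subseteq> vs.span C"
    using vs.maximal_independent_subset[of B] by metis
  have "vs.span C = UNIV"
    using B(2) C(3) vs.span_minimal[OF C(3) vs.subspace_span] by auto
  moreover have "finite C"
    using B(1) C(1) finite_subset by blast
  ultimately have "finite_dimensional_vector_space (restrict_scalars s) C"
    using C(2) by unfold_locales
  then show thesis by (rule that)
qed

lemma subspace_restrict_scalars:
  fixes s :: "('n::finite, 'k::field) mpoly \<Rightarrow> 'v::ab_group_add \<Rightarrow> 'v"
  assumes "module s" and "module.subspace s N"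
  shows "module.subspace (restrict_scalars s) N"
proof -
  interpret s: module s by fact
  interpret vs: vector_space "restrict_scalars s"
    by (rule vector_space_restrict_scalars) fact
  show ?thesis
    using assms(2) unfolding s.subspace_def vs.subspace_def restrict_scalars_def by blast
qed

text \<open>Among the nonzero submodules of \<open>N\<close>, one of least dimension is minimal.\<close>
lemma ex_minimal_submodule:
  fixes s :: "('n::finite, 'k::field) mpoly \<Rightarrow> 'v::ab_group_add \<Rightarrow> 'v"
  assumes "module s" and fin: "\<exists>B. finite B \<and> module.span (restrict_scalars s) B = UNIV"
    and N: "module.subspace s N" "N \<noteq> {0}"
  obtains M where "minimal_submodule s M" and "M \<subseteq> N"
proof -
  obtain B where B: "finite_dimensional_vector_space (restrict_scalars s) B"
    using finite_dimensional_restrict_scalars[OF assms(1) fin] .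
  interpret vs: finite_dimensional_vector_space "restrict_scalars s" B by fact
  let ?P = "\<lambda>M. module.subspace s M \<and> M \<noteq> {0} \<and> M \<subseteq> N"
  define M where "M = (ARG_MIN vs.dim M. ?P M)"
  have M: "?P M" and least: "\<And>L. ?P L \<Longrightarrow> vs.dim M \<le> vs.dim L"
    using arg_min_nat_lemma[of ?P N vs.dim] N unfolding M_def by auto
  have "L = M" if "module.subspace s L" "L \<subseteq> M" "L \<noteq> {0}" for L
    using that M least[of L] subspace_restrict_scalars[OF assms(1)]
    by (intro vs.subspace_dim_equal) auto
  then have "minimal_submodule s M"
    using M unfolding minimal_submodule_def by blast
  then show thesis using that M by blast
qed

text \<open>
  A vector spanning the socle lies in every nonzero submodule, since such a submodule contains a
  minimal one, hence a nonzero multiple of that vector. It is a common eigenvector because the socle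
  is a submodule.
\<close>
lemma one_dimensional_socle_vector:
  fixes s :: "('n::finite, 'k::field) mpoly \<Rightarrow> 'v::ab_group_add \<Rightarrow> 'v"
  assumes "module s" and fin: "\<exists>B. finite B \<and> module.span (restrict_scalars s) B = UNIV"
    and dim: "vector_space.dim (restrict_scalars s) (socle s) = 1"
  obtains u where "u \<noteq> 0"
    and "\<And>N. module.subspace s N \<Longrightarrow> N \<noteq> {0} \<Longrightarrow> u \<in> N"
    and "\<And>p. \<exists>c. s p u = s (mconst c) u"
proof -
  interpret s: module s by fact
  interpret vs: vector_space "restrict_scalars s"
    by (rule vector_space_restrict_scalars) fact
  obtain B where B: "B \<subseteq> socle s" "vs.independent B" "socle s \<subseteq> vs.span B" "card B = 1"
    using vs.basis_exists[of "socle s"] dim by metis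
  then obtain u where u: "B = {u}"
    using card_1_singletonE by blast
  have "u \<noteq> 0"
    using B(2) u vs.dependent_zero by auto
  have line: "\<exists>c. v = s (mconst c) u" if "v \<in> socle s" for v
    using that B(3) u by (auto simp: vs.span_singleton restrict_scalars_def)
  have "u \<in> N" if N: "module.subspace s N" "N \<noteq> {0}" for N
  proof -
    obtain M where M: "minimal_submodule s M" "M \<subseteq> N"
      using ex_minimal_submodule[OF assms(1) fin N] .
    then obtain v where v: "v \<in> M" "v \<noteq> 0"
      unfolding minimal_submodule_def using s.subspace_0 by blast
    have "v \<in> socle s"
      unfolding socle_def using v(1) M(1) by (intro s.span_base) auto
    then obtain c where c: "v = restrict_scalars s c u"
      using line by (auto simp: restrict_scalars_def)
    with v(2) have "c \<noteq> 0"
      by auto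
    have "restrict_scalars s (inverse c) v \<in> N"
      unfolding restrict_scalars_def using M(2) v(1) N(1) by (auto intro: s.subspace_scale)
    with c \<open>c \<noteq> 0\<close> show ?thesis
      by simp
  qed
  moreover have "\<exists>c. s p u = s (mconst c) u" for p
    using B(1) u line[of "s p u"] by (simp add: socle_def s.span_scale)
  ultimately show thesis
    using that \<open>u \<noteq> 0\<close> by blast
qed

text \<open>
  The kernels of the powers of \<open>t\<close> form an increasing chain of subspaces, which is constant from some
  \<open>N\<close> on. If \<open>t^N V\<close> were nonzero, it would contain \<open>u\<close>, say \<open>u = t^N w\<close>. Then \<open>t^(N+1) w = t u = 0\<close>,
  and \<open>u = t^N w = 0\<close> by the choice of \<open>N\<close>.
\<close>
lemma nilpotent_if_kills_common_vector:
  fixes s :: "('n::finite, 'k::field) mpoly \<Rightarrow> 'v::ab_group_add \<Rightarrow> 'v"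
  assumes "module s" and fin: "\<exists>B. finite B \<and> module.span (restrict_scalars s) B = UNIV"
    and "u \<noteq> 0"
    and common: "\<And>N. module.subspace s N \<Longrightarrow> N \<noteq> {0} \<Longrightarrow> u \<in> N"
    and "s t u = 0"
  shows "\<exists>N. \<forall>v. s (t ^ N) v = 0"
proof -
  interpret s: module s by fact
  obtain B where B: "finite_dimensional_vector_space (restrict_scalars s) B"
    using finite_dimensional_restrict_scalars[OF assms(1) fin] .
  interpret vs: finite_dimensional_vector_space "restrict_scalars s" B by fact
  define K where "K k = {v. s (t ^ k) v = 0}" for k
  have K: "vs.subspace (K k)" for k
  proof -
    have "s (t ^ k) (s p v) = s p (s (t ^ k) v)" for p v
      by (simp add: mult.commute)
    then have "s.subspace (K k)"
      unfolding K_def s.subspace_def by (auto simp: s.scale_right_distrib simp del: s.scale_scale)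
    then show ?thesis
      by (rule subspace_restrict_scalars[OF assms(1)])
  qed
  (* A kernel of largest dimension exists because the dimension of V bounds them all. *)
  obtain N where N: "\<And>k. vs.dim (K k) \<le> vs.dim (K N)"
    using ex_has_greatest_nat[of "\<lambda>_. True" 0 "\<lambda>k. vs.dim (K k)" "Suc vs.dimension"]
      vs.dim_subset_UNIV by (auto simp: less_Suc_eq_le)
  have "K N \<subseteq> K (Suc N)"
    unfolding K_def by (auto simp flip: s.scale_scale)
  then have stable: "K (Suc N) = K N"
    using vs.subspace_dim_equal[OF K K _ N] by blast
  have range: "s.subspace (range (s (t ^ N)))"
  proof -
    have "s p (s (t ^ N) v) = s (t ^ N) (s p v)" for p v
      by (simp add: mult.commute)
    moreover have "0 = s (t ^ N) 0"
      by simp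
    ultimately show ?thesis
      unfolding s.subspace_def by (auto simp flip: s.scale_right_distrib simp del: s.scale_scale s.scale_zero_right)
  qed
  have "range (s (t ^ N)) = {0}"
  proof (rule ccontr)
    assume "range (s (t ^ N)) \<noteq> {0}"
    then obtain w where w: "u = s (t ^ N) w"
      using common[OF range] by blast
    then have "w \<in> K (Suc N)"
      using \<open>s t u = 0\<close> unfolding K_def by simp
    then have "w \<in> K N"
      using stable by simp
    then show False
      using w \<open>u \<noteq> 0\<close> unfolding K_def by simp
  qed
  then show ?thesis by blast
qed

section \<open>The embedding\<close>

definition shifted_monom :: "('n::finite \<Rightarrow> 'k::comm_ring_1) \<Rightarrow> 'n expo \<Rightarrow> ('n, 'k) mpoly" where
  "shifted_monom \<alpha> m = (\<Prod>i\<in>UNIV. (mvar i - mconst (\<alpha> i)) ^ lookup m i)"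

lemma shifted_monom_0 [simp]: "shifted_monom \<alpha> 0 = 1"
  by (simp add: shifted_monom_def)

text \<open>
  The common step for the monomials and for the factorials: raising the exponent of \<open>x_i\<close> by one
  changes only the factor with index \<open>i\<close>.
\<close>
lemma prod_lookup_add_single:
  fixes F :: "'n::finite \<Rightarrow> nat \<Rightarrow> 'b::comm_monoid_mult"
  assumes "\<And>k. F i (Suc k) = c k * F i k"
  shows "(\<Prod>j\<in>UNIV. F j (lookup (m + Poly_Mapping.single i 1) j)) =
    c (lookup m i) * (\<Prod>j\<in>UNIV. F j (lookup m j))"
proof -
  have "(\<Prod>j\<in>UNIV - {i}. F j (lookup (m + Poly_Mapping.single i 1) j)) =
      (\<Prod>j\<in>UNIV - {i}. F j (lookup m j))"
    by (rule prod.cong) (auto simp: lookup_add lookup_single when_def)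
  then show ?thesis
    by (simp add: prod.remove[of UNIV i] lookup_add assms mult.assoc)
qed

lemma shifted_monom_add_single:
  "shifted_monom \<alpha> (m + Poly_Mapping.single i 1) = (mvar i - mconst (\<alpha> i)) * shifted_monom \<alpha> m"
  unfolding shifted_monom_def
  by (rule prod_lookup_add_single[of "\<lambda>j k. (mvar j - mconst (\<alpha> j)) ^ k" i "\<lambda>_. mvar i - mconst (\<alpha> i)"])
    simp

definition expo_fact :: "'n::finite expo \<Rightarrow> 'k::field_char_0" where
  "expo_fact m = (\<Prod>i\<in>UNIV. fact (lookup m i))"

lemma expo_fact_0 [simp]: "expo_fact 0 = 1"
  by (simp add: expo_fact_def)

lemma expo_fact_add_single:
  "expo_fact (m + Poly_Mapping.single i 1) = of_nat (lookup m i + 1) * (expo_fact m :: 'k::field_char_0)"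
  unfolding expo_fact_def
  by (rule prod_lookup_add_single[of "\<lambda>_. fact" i "\<lambda>k. of_nat (k + 1)"]) simp

text \<open>
  Let \<open>g\<close> be a linear map from \<open>V\<close> to power series under which the action of \<open>x_i - \<alpha>_i\<close> becomes
  \<open>\<partial>/\<partial>x_i\<close>. If \<open>g v\<close> has constant term \<open>l v\<close> for all \<open>v\<close>, then Taylor's formula forces the
  coefficients chosen here.
\<close>
definition taylor_series ::
    "(('n::finite, 'k::field_char_0) mpoly \<Rightarrow> 'v \<Rightarrow> 'v) \<Rightarrow> ('n \<Rightarrow> 'k) \<Rightarrow> ('v \<Rightarrow> 'k) \<Rightarrow> 'v \<Rightarrow> ('n, 'k) mfps" where
  "taylor_series s \<alpha> l v = Abs_mfps (\<lambda>m. l (s (shifted_monom \<alpha> m) v) / expo_fact m)"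

lemma mfps_deriv_taylor_series:
  fixes s :: "('n::finite, 'k::field_char_0) mpoly \<Rightarrow> 'v::ab_group_add \<Rightarrow> 'v"
  assumes "module s"
  shows "mfps_deriv i (taylor_series s \<alpha> l v) = taylor_series s \<alpha> l (s (mvar i - mconst (\<alpha> i)) v)"
proof (rule mfps_eqI)
  fix m
  interpret s: module s by fact
  have "of_nat (lookup m i + 1) \<noteq> (0 :: 'k)"
    by (metis add_is_0 of_nat_eq_0_iff one_neq_zero)
  then show "mfps_nth (mfps_deriv i (taylor_series s \<alpha> l v)) m =
      mfps_nth (taylor_series s \<alpha> l (s (mvar i - mconst (\<alpha> i)) v)) m"
    unfolding mfps_nth_deriv taylor_series_def mfps_nth_Abs shifted_monom_add_single
      expo_fact_add_single
    by (simp add: mult.commute del: of_nat_add of_nat_Suc)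
qed

text \<open>
  If \<open>(x_i - \<alpha>_i)^(N i)\<close> annihilates \<open>V\<close> for all \<open>i\<close>, then only exponents with \<open>m_i < N i\<close> for all
  \<open>i\<close> can have a nonzero coefficient, and there are finitely many of them.
\<close>
lemma taylor_series_polynomial:
  fixes s :: "('n::finite, 'k::field_char_0) mpoly \<Rightarrow> 'v::ab_group_add \<Rightarrow> 'v"
  assumes "module s" and "l 0 = 0"
    and nilpotent: "\<And>i. \<exists>N. \<forall>v. s ((mvar i - mconst (\<alpha> i)) ^ N) v = 0"
  shows "\<exists>f. taylor_series s \<alpha> l v = mfps_of_mpoly f"
proof -
  interpret s: module s by fact
  obtain N where N: "\<And>i v. s ((mvar i - mconst (\<alpha> i)) ^ N i) v = 0"
    using nilpotent by metis
  define b :: "'n expo" where "b = Abs_poly_mapping N"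
  have b: "lookup b = N"
    unfolding b_def by (rule Abs_poly_mapping_inverse) simp
  let ?c = "\<lambda>m. l (s (shifted_monom \<alpha> m) v) / expo_fact m"
  have vanish: "?c m = 0" if "\<not> (\<forall>i. lookup m i \<le> lookup b i)" for m
  proof -
    obtain i where "N i \<le> lookup m i"
      using \<open>\<not> _\<close> b by (metis nle_le)
    then have "(mvar i - mconst (\<alpha> i)) ^ N i dvd (mvar i - mconst (\<alpha> i)) ^ lookup m i"
      by (rule le_imp_power_dvd)
    moreover have "(mvar i - mconst (\<alpha> i)) ^ lookup m i dvd shifted_monom \<alpha> m"
      unfolding shifted_monom_def by (rule dvd_prodI) auto
    ultimately obtain q where "shifted_monom \<alpha> m = (mvar i - mconst (\<alpha> i)) ^ N i * q"
      using dvd_trans by (blast elim: dvdE)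
    then have "s (shifted_monom \<alpha> m) v = 0"
      using N by (simp flip: s.scale_scale)
    then show ?thesis
      using \<open>l 0 = 0\<close> by simp
  qed
  have "finite {m. ?c m \<noteq> 0}"
    by (rule finite_subset[OF _ finite_expo_le[of b]]) (use vanish in blast)
  then have "taylor_series s \<alpha> l v = mfps_of_mpoly (Abs_poly_mapping ?c)"
    by (simp add: taylor_series_def mfps_of_mpoly_def Abs_poly_mapping_inverse)
  then show ?thesis ..
qed

text \<open>
  By the product rule, multiplication by \<open>exp (\<Sum>i. \<alpha>_i x_i)\<close> conjugates the operator \<open>\<partial>/\<partial>x_i + \<alpha>_i\<close> into
  \<open>\<partial>/\<partial>x_i\<close>. The former is what \<open>x_i = (x_i - \<alpha>_i) + \<alpha>_i\<close> becomes under the Taylor series.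
\<close>
lemma module_hom_exp_taylor_series:
  fixes s :: "('n::finite, 'k::field_char_0) mpoly \<Rightarrow> 'v::ab_group_add \<Rightarrow> 'v"
  assumes "module s"
    and add: "\<And>v w. l (v + w) = l v + l w" and scale: "\<And>c v. l (s (mconst c) v) = c * l v"
  shows "module_hom s P_act (\<lambda>v. mfps_exp (mfps_of_mpoly (linear_form \<alpha>)) * taylor_series s \<alpha> l v)"
proof (rule module_hom_P_actI[OF assms(1)])
  interpret s: module s by fact
  let ?E = "mfps_exp (mfps_of_mpoly (linear_form \<alpha>))" and ?g = "taylor_series s \<alpha> l"
  have g_add: "?g (v + w) = ?g v + ?g w" for v w
    by (rule mfps_eqI) (simp add: taylor_series_def s.scale_right_distrib add add_divide_distrib)
  have g_scale: "?g (s (mconst c) v) = mfps_smult c (?g v)" for c v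
  proof (rule mfps_eqI)
    fix m
    have "s (shifted_monom \<alpha> m) (s (mconst c) v) = s (mconst c) (s (shifted_monom \<alpha> m) v)"
      by (simp add: mult.commute)
    then show "mfps_nth (?g (s (mconst c) v)) m = mfps_nth (mfps_smult c (?g v)) m"
      by (simp add: taylor_series_def scale del: s.scale_scale)
  qed
  show "?E * ?g (v + w) = ?E * ?g v + ?E * ?g w" for v w
    by (simp add: g_add distrib_left)
  show "?E * ?g (s (mconst c) v) = mfps_smult c (?E * ?g v)" for c v
    by (simp add: g_scale mfps_smult_mult_right)
  show "?E * ?g (s (mvar i) v) = mfps_deriv i (?E * ?g v)" for i v
  proof -
    have "s (mvar i) v = s (mconst (\<alpha> i)) v + s (mvar i - mconst (\<alpha> i)) v"
      by (simp add: s.scale_left_diff_distrib)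
    then have "?g (s (mvar i) v) = mfps_smult (\<alpha> i) (?g v) + mfps_deriv i (?g v)"
      by (simp only: g_add g_scale mfps_deriv_taylor_series[OF assms(1)])
    then show ?thesis
      by (simp add: mfps_deriv_mult mfps_deriv_exp_linear_form distrib_left mfps_smult_mult_left
          mfps_smult_mult_right)
  qed
qed

theorem corollary1:
  fixes s :: "('n::finite, 'k::{alg_closed_field, field_char_0}) mpoly \<Rightarrow> 'v::ab_group_add \<Rightarrow> 'v"
  assumes "module s"
    and "\<exists>B. finite B \<and> module.span (restrict_scalars s) B = UNIV"
    and "vector_space.dim (restrict_scalars s) (socle s) = 1"
  shows "\<exists>(\<alpha> :: 'n \<Rightarrow> 'k) W \<phi>. module.subspace P_act W \<and> W \<subseteq> D_set \<alpha> \<and>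
           module_hom s P_act \<phi> \<and> bij_betw \<phi> UNIV W"
proof -
  interpret s: module s by fact
  interpret vs: vector_space "restrict_scalars s"
    by (rule vector_space_restrict_scalars) fact
  obtain u where "u \<noteq> 0"
    and common: "\<And>N. s.subspace N \<Longrightarrow> N \<noteq> {0} \<Longrightarrow> u \<in> N"
    and eigenvector: "\<And>p. \<exists>c. s p u = s (mconst c) u"
    using one_dimensional_socle_vector[OF assms] by blast
  have "\<forall>i. \<exists>c. s (mvar i) u = s (mconst c) u"
    using eigenvector by blast
  then obtain \<alpha> where \<alpha>: "\<And>i. s (mvar i) u = s (mconst (\<alpha> i)) u"
    by metis
  have nilpotent: "\<exists>N. \<forall>v. s ((mvar i - mconst (\<alpha> i)) ^ N) v = 0" for i
    by (rule nilpotent_if_kills_common_vector[OF assms(1,2) \<open>u \<noteq> 0\<close> common])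
      (simp_all add: s.scale_left_diff_distrib \<alpha>)

  (* A linear functional taking the value 1 at u. *)
  define C where "C = vs.extend_basis {u}"
  have C: "vs.independent C" "vs.span C = UNIV" "u \<in> C"
    using vs.independent_extend_basis[of "{u}"] vs.span_extend_basis[of "{u}"]
      vs.extend_basis_superset[of "{u}"] \<open>u \<noteq> 0\<close> by (auto simp: C_def)
  define l where "l v = vs.representation C v u" for v
  have l_add: "l (v + w) = l v + l w" for v w
    using C by (simp add: l_def vs.representation_add)
  have l_scale: "l (s (mconst c) v) = c * l v" for c v
    using C vs.representation_scale[of C v c] by (simp add: l_def restrict_scalars_def)
  have l_0: "l 0 = 0"
    using l_add[of 0 0] by simp
  have l_u: "l u = 1"
    using C by (simp add: l_def vs.representation_basis)

  define E where "E = mfps_exp (mfps_of_mpoly (linear_form \<alpha>))"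
  define \<phi> where "\<phi> v = E * taylor_series s \<alpha> l v" for v
  have "module_hom s P_act \<phi>"
    using module_hom_exp_taylor_series[of s l \<alpha>] assms(1) l_add l_scale
    unfolding \<phi>_def E_def by blast
  then interpret \<phi>: module_hom s P_act \<phi> .
  have "mfps_nth (\<phi> u) 0 = 1"
    by (simp add: \<phi>_def mfps_nth_mult_0 E_def mfps_nth_exp_0 linear_form_const_coeff
        taylor_series_def l_u)
  then have "u \<notin> {v. \<phi> v = 0}"
    by auto
  then have "{v. \<phi> v = 0} = {0}"
    using common[OF \<phi>.subspace_kernel] by blast
  then have "inj \<phi>"
    by (auto simp: \<phi>.inj_iff_eq_0)
  moreover have "range \<phi> \<subseteq> D_set \<alpha>"
  proof clarify
    fix v
    obtain f where "taylor_series s \<alpha> l v = mfps_of_mpoly f"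
      using taylor_series_polynomial[of s l \<alpha>, OF assms(1) l_0 nilpotent] by blast
    then show "\<phi> v \<in> D_set \<alpha>"
      by (auto simp: D_set_def \<phi>_def E_def)
  qed
  moreover have "module.subspace P_act (range \<phi>)"
    by (rule \<phi>.subspace_image[OF s.subspace_UNIV])
  ultimately show ?thesis
    using \<open>module_hom s P_act \<phi>\<close> by (blast intro: inj_on_imp_bij_betw)
qed

end
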